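(* Let $\alpha_N=\alpha_N(\delta_A,\delta_B)$ and $\beta_N=\beta_N(\delta_A,\delta_B)$ be the error-consistent functions with the explicit expressions given in the context, for which $\widehat V_N(x)\le(1+\alpha_N)V_\infty(x)+\beta_N$ for all $x\in\mathcal X_{\mathrm{ROA}}$. Let $\xi_N=\xi_N(\delta_A,\delta_B)$ (error-consistent) and the constant $\eta_N$ be as given explicitly in the context, satisfying $\xi_N+\eta_N<1$ and $\widehat V_N(Ax+B\widehat\mu_N(x))-\widehat V_N(x)\le-(1-\xi_N-\eta_N)\,l(x,\widehat\mu_N(x))$ for all $x\in\mathcal X_{\mathrm{ROA}}$. Then, for the initial state $x(0)=x\in\mathcal X_{\mathrm{ROA}}$, the closed-loop infinite-horizon cost of the nominal MPC controller applied to the true system satisfies $$J^{[\widehat\mu_N]}_\infty(x)\;\le\;\frac{1+\alpha_N}{1-\xi_N-\eta_N}\,V_\infty(x)+\frac{\beta_N}{1-\xi_N-\eta_N}.$$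
   Context: A function $\alpha:\mathbb R_+^2\to\mathbb R_+$ is *error-consistent* if it is non-decreasing in each argument separately and $\alpha(\delta_1,\delta_2)=0$ if and only if $\delta_1=\delta_2=0$. **Systems.** The true system is $x(t+1)=Ax(t)+Bu(t)$, $A\in\mathbb R^{n\times n}$, $B\in\mathbb R^{n\times m}$, with inputs in $\mathcal U=\{u\in\mathbb R^m: F_uu\le \mathbf 1_{c_u}\}$ (componentwise, $F_u\in\mathbb R^{c_u\times m}$, $\mathbf 1_{c_u}$ the all-ones vector). The estimated matrices $\widehat A,\widehat B$ satisfy $\|A-\widehat A\|_{\mathrm F}\le\delta_A$, $\|B-\widehat B\|_{\mathrm F}\le\delta_B$ with $\delta_A,\delta_B\ge0$. Both $(A,B)$ and $(\widehat A,\widehat B)$ are stabilizable. **Costs.** $Q,R$ are symmetric positive definite, $\|x\|_M^2=x^\top Mx$, $l(x,u)=\|x\|_Q^2+\|u\|_R^2$, $l^\ast(x)=\min_{u\in\mathcal U}l(x,u)=\|x\|_Q^2$. For symmetric $M\succ0$, $\overline\sigma_M,\underline\sigma_M$ are its largest and smallest eigenvalues and $r_M=\overline\sigma_M/\underline\sigma_M$. $V_\infty(x)$ is the optimal value of $\sum_{t=0}^\infty l(x_t,u_t)$ over $u_t\in\mathcal U$, $x_{t+1}=Ax_t+Bu_t$, $x_0=x$. $\mathcal X_{\mathrm{ROA}}$ is the region of attraction, on which $V_\infty$ is finite; the initial state $x(0)$ is assumed to lie in $\mathcal X_{\mathrm{ROA}}$. **Nominal MPC.** For a prediction horizon $N\ge1$,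 $\widehat V_N(x)$ is the minimum of $\sum_{k=0}^N(\|x_k\|_Q^2+\|u_k\|_R^2)$ subject to $x_0=x$, $x_{k+1}=\widehat Ax_k+\widehat Bu_k$ for $0\le k\le N-1$, $u_k\in\mathcal U$ for $0\le k\le N$; $\widehat\mu_N(x)$ is the first element ($k=0$) of the minimizing input sequence. With $x(0)=x$ and $x(t+1)=Ax(t)+B\widehat\mu_N(x(t))$, set $J_\infty^{[\widehat\mu_N]}(x)=\sum_{t=0}^\infty l(x(t),\widehat\mu_N(x(t)))$. **Definition of $\alpha_N,\beta_N$.** For $i\in\mathbb N$, $\nu\in\{1,2\}$ let $g^{(\nu)}_{i,(x)}=[(\delta_A+\|\widehat A\|_2)^i-\|\widehat A\|_2^i]^\nu$ and $g^{(\nu)}_{i,(u)}=\{(\delta_B+\|\widehat B\|_2)g^{(1)}_{i,(x)}+\delta_B\|\widehat A\|_2^i\}^\nu$; $\bar g_{(x)}=\sum_{i=1}^Ng^{(1)}_{i,(x)}$, $\bar g_{(u)}=\sum_{i=1}^N\sum_{j=0}^{i-1}g^{(1)}_{j,(u)}$. Let $\widehat\Phi_N=[I,\widehat A^\top,\dots,(\widehat A^N)^\top]^\top$ and let $\widehat\Gamma_N$ be the block matrix with block rows $i=0,\dots,N$, block columns $j=0,\dots,N-1$, whose $(i,j)$ block is $\widehat A^{i-1-j}\widehat B$ if $j<i$ and $0$ otherwise. Let $\theta_{N,(u)}=\overline\sigma_Q(2\|\widehat\Gamma_N\|_2\bar g_{(u)}+\bar g_{(u)}^2)$, $\theta_{N,(x,u)}=\overline\sigma_Q(\|\widehat\Gamma_N\|_2\bar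 g_{(x)}+\|\widehat\Phi_N\|_2\bar g_{(u)}+\bar g_{(x)}\bar g_{(u)})$, $\widehat H_N=I_N\otimes R+\widehat\Gamma_N^\top(I_{N+1}\otimes Q)\widehat\Gamma_N$, $\overline u=\max_{u\in\mathcal U}\|u\|_2^2$, $\overline d_u=\max_{u_1,u_2\in\mathcal U}\|u_1-u_2\|_2^2$. Define $$E_{N,(\psi)}=\overline\sigma_Q\sum_{k=0}^N\Big[\Big(g^{(2)}_{k,(x)}+\sum_{i=0}^{k-1}g^{(2)}_{k-i-1,(u)}\Big)(\|x\|_2^2+k\overline u)\Big],$$ $$E_{N,(u)}=\overline\sigma_R\Big(\min\Big\{(N\overline d_u)^{1/2},\ \tfrac1{\underline\sigma_{\widehat H_N}}\big((N\overline u)^{1/2}\theta_{N,(u)}+\|x\|_2\theta_{N,(x,u)}\big)\Big\}\Big)^2,$$ $$E_{N,(\psi,u)}=\frac{\overline\sigma_Q}{\overline\sigma_R}\big(\|\widehat\Gamma_N\|_2+\bar g_{(u)}\big)^2E_{N,(u)}.$$ With pairs $(p_i,q_i)\in\mathbb R_+^2$ satisfying $p_iq_i=1$ ($i=1,2,3$), $$\alpha_N=\max\big\{p_1E_{N,(\psi)}^{1/2}+p_3E_{N,(\psi,u)}^{1/2}+p_1p_3(E_{N,(\psi)}E_{N,(\psi,u)})^{1/2},\ p_2E_{N,(u)}^{1/2}\big\},$$ $$\beta_N=(1+p_1E_{N,(\psi)}^{1/2})(q_3E_{N,(\psi,u)}^{1/2}+E_{N,(\psi,u)})+q_2E_{N,(u)}^{1/2}+E_{N,(u)}+q_1E_{N,(\psi)}^{1/2}+E_{N,(\psi)}.$$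 **Definition of $\xi_N,\eta_N$.** Let $u=Kx$ be a linear stabilizing control law for $(\widehat A,\widehat B)$. Let $\varepsilon_K=\min_i 1/\|[F_uK]_{(i,:)}^\top\|_{Q^{-1}}^2$ ($[F_uK]_{(i,:)}$ is the $i$-th row) and $\Omega_K=\{x:l^\ast(x)\le\varepsilon_K\}$, so that $Kx\in\mathcal U$ on $\Omega_K$. Let $\lambda_K\ge1$, $\rho_K\in(0,1)$ be constants (which exist) such that, with $C_K^\ast=(1+\underline\sigma_Q^{-1}\overline\sigma_R\|K\|_2^2)r_Q\lambda_K^2$, $l(z_k,Kz_k)\le C_K^\ast\rho_K^kl^\ast(x)$ for all $x\in\Omega_K$, $k\in\mathbb N$, where $z_k=(\widehat A+\widehat BK)^kx$. Let $\gamma=C_K^\ast(1-\rho_K)^{-1}$, $\rho_\gamma=\gamma^{-1}(\gamma-1)$. Let $M_{\widehat V}$ be an upper bound of $\widehat V_N(x)$ for all $x=x(0)$, $L_{\widehat V}=\max\{\gamma,M_{\widehat V}/\varepsilon_K\}$, $N_0=\lceil\max\{0,(M_{\widehat V}-\gamma\varepsilon_K)/\varepsilon_K\}\rceil$. With $G_N(\widehat A)=\sum_{i=1}^{N-1}\|\widehat A\|_2^{2(i-1)}$ and $h(\delta_A,\delta_B)=\underline\sigma_Q^{-1}\delta_A^2+\underline\sigma_R^{-1}\delta_B^2$, $$\eta_N=\|\widehat A\|_2^2r_Q\gamma\rho_\gamma^{N-N_0},\qquad \xi_N=\omega_{N,(1)}h(\delta_A,\delta_B)+2\omega_{N,(\frac12)}h^{1/2}(\delta_A,\delta_B),$$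 $$\omega_{N,(1)}=\overline\sigma_Q\big[(1+\|\widehat A\|_2^2r_Q)\|\widehat A\|_2^{2(N-1)}+G_N(\widehat A)\big],$$ $$\omega_{N,(\frac12)}=\big[\overline\sigma_Q(L_{\widehat V}-1)G_N(\widehat A)\big]^{1/2}+\frac{1+\|\widehat A\|_2^2r_Q}{2}\big[\overline\sigma_Q\|\widehat A\|_2^{2(N-1)}\gamma\rho_\gamma^{N-N_0}\big]^{1/2}.$$ *)

theory Defs
  imports "HOL-Analysis.Analysis"
begin

section \<open>Error-consistent functions\<close>

definition error_consistent :: "(real \<Rightarrow> real \<Rightarrow> real) \<Rightarrow> bool" where
  "error_consistent f \<longleftrightarrow>
     (\<forall>d1\<ge>0. \<forall>d2\<ge>0. 0 \<le> f d1 d2) \<and>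
     (\<forall>d1\<ge>0. \<forall>d1'\<ge>d1. \<forall>d2\<ge>0. f d1 d2 \<le> f d1' d2) \<and>
     (\<forall>d1\<ge>0. \<forall>d2\<ge>0. \<forall>d2'\<ge>d2. f d1 d2 \<le> f d1 d2') \<and>
     (\<forall>d1\<ge>0. \<forall>d2\<ge>0. f d1 d2 = 0 \<longleftrightarrow> d1 = 0 \<and> d2 = 0)"


section \<open>Matrices\<close>

text \<open>The library power operation on type \<^typ>\<open>real^'n^'n\<close> is componentwise, hence a separate
  matrix power. The Frobenius norm needs no definition: it is the library \<^term>\<open>norm\<close> on matrices,
  which is the Euclidean norm of the Euclidean norms of the rows.\<close>

primrec mpow :: "'a::semiring_1^'n^'n \<Rightarrow> nat \<Rightarrow> 'a^'n^'n" where
  "mpow M 0 = mat 1"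
| "mpow M (Suc k) = M ** mpow M k"

abbreviation spectral_norm :: "real^'n^'m \<Rightarrow> real" where
  "spectral_norm M \<equiv> onorm (\<lambda>v. M *v v)"

definition eigenvalues :: "'a::field^'n^'n \<Rightarrow> 'a set" where
  "eigenvalues M = {c. \<exists>v. v \<noteq> 0 \<and> M *v v = c *s v}"

definition sym_posdef :: "real^'n^'n \<Rightarrow> bool" where
  "sym_posdef M \<longleftrightarrow> transpose M = M \<and> (\<forall>v. v \<noteq> 0 \<longrightarrow> 0 < v \<bullet> (M *v v))"

definition sig_max :: "real^'n^'n \<Rightarrow> real" where
  "sig_max M = Max (eigenvalues M)"

definition sig_min :: "real^'n^'n \<Rightarrow> real" where
  "sig_min M = Min (eigenvalues M)"

definition cond_ratio :: "real^'n^'n \<Rightarrow> real" where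
  "cond_ratio M = sig_max M / sig_min M"

definition wnorm_sq :: "real^'n^'n \<Rightarrow> real^'n \<Rightarrow> real" where
  "wnorm_sq M v = v \<bullet> (M *v v)"

definition schur_stable :: "real^'n^'n \<Rightarrow> bool" where
  "schur_stable M \<longleftrightarrow> (\<forall>c \<in> eigenvalues (map_matrix complex_of_real M). cmod c < 1)"

definition stabilizing_gain :: "real^'n^'n \<Rightarrow> real^'m^'n \<Rightarrow> real^'n^'m \<Rightarrow> bool" where
  "stabilizing_gain A B K \<longleftrightarrow> schur_stable (A + B ** K)"

definition stabilizable :: "real^'n^'n \<Rightarrow> real^'m^'n \<Rightarrow> bool" where
  "stabilizable A B \<longleftrightarrow> (\<exists>K. stabilizing_gain A B K)"


section \<open>Block matrices\<close>

text \<open>The stacked matrices have a number of block rows and columns that depends on the horizon.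
  A block vector is a function from block indices to vectors, a block matrix a function from
  block row and block column indices to matrices; the numbers of blocks are passed explicitly and
  only indices below them are relevant.\<close>

definition block_norm :: "nat \<Rightarrow> (nat \<Rightarrow> real^'m) \<Rightarrow> real" where
  "block_norm c v = L2_set (\<lambda>j. norm (v j)) {..<c}"

definition block_mult_vec ::
  "nat \<Rightarrow> (nat \<Rightarrow> nat \<Rightarrow> real^'m^'n) \<Rightarrow> (nat \<Rightarrow> real^'m) \<Rightarrow> nat \<Rightarrow> real^'n" where
  "block_mult_vec c M v i = (\<Sum>j<c. M i j *v v j)"

definition block_mult ::
  "nat \<Rightarrow> (nat \<Rightarrow> nat \<Rightarrow> real^'m^'n) \<Rightarrow> (nat \<Rightarrow> nat \<Rightarrow> real^'k^'m) \<Rightarrow> nat \<Rightarrow> nat \<Rightarrow> real^'k^'n" where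
  "block_mult c M L i j = (\<Sum>k<c. M i k ** L k j)"

definition block_transpose :: "(nat \<Rightarrow> nat \<Rightarrow> real^'m^'n) \<Rightarrow> nat \<Rightarrow> nat \<Rightarrow> real^'n^'m" where
  "block_transpose M i j = transpose (M j i)"

text \<open>The Kronecker product of an identity matrix with \<open>M\<close>.\<close>

definition block_diag :: "real^'n^'n \<Rightarrow> nat \<Rightarrow> nat \<Rightarrow> real^'n^'n" where
  "block_diag M i j = (if i = j then M else 0)"

text \<open>Spectral norm of a block matrix with \<open>r\<close> block rows and \<open>c\<close> block columns, in the
  form of the library definition of \<^term>\<open>onorm\<close>.\<close>

definition block_spectral_norm :: "nat \<Rightarrow> nat \<Rightarrow> (nat \<Rightarrow> nat \<Rightarrow> real^'m^'n) \<Rightarrow> real" where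
  "block_spectral_norm r c M = (SUP v. block_norm r (block_mult_vec c M v) / block_norm c v)"

definition block_eigenvalues :: "nat \<Rightarrow> (nat \<Rightarrow> nat \<Rightarrow> real^'m^'m) \<Rightarrow> real set" where
  "block_eigenvalues c M =
     {a. \<exists>v. (\<exists>i<c. v i \<noteq> 0) \<and> (\<forall>i<c. block_mult_vec c M v i = a *\<^sub>R v i)}"

definition block_sig_min :: "nat \<Rightarrow> (nat \<Rightarrow> nat \<Rightarrow> real^'m^'m) \<Rightarrow> real" where
  "block_sig_min c M = Min (block_eigenvalues c M)"


section \<open>Systems, costs and the nominal controller\<close>

definition input_set :: "real^'m^'c \<Rightarrow> (real^'m) set" where
  "input_set F = {u. \<forall>i. (F *v u) $ i \<le> 1}"

primrec traj :: "real^'n^'n \<Rightarrow> real^'m^'n \<Rightarrow> real^'n \<Rightarrow> (nat \<Rightarrow> real^'m) \<Rightarrow> nat \<Rightarrow> real^'n" where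
  "traj A B x u 0 = x"
| "traj A B x u (Suc k) = A *v traj A B x u k + B *v u k"

definition stage_cost :: "real^'n^'n \<Rightarrow> real^'m^'m \<Rightarrow> real^'n \<Rightarrow> real^'m \<Rightarrow> real" where
  "stage_cost Q R x u = wnorm_sq Q x + wnorm_sq R u"

definition min_stage_cost :: "real^'m^'c \<Rightarrow> real^'n^'n \<Rightarrow> real^'m^'m \<Rightarrow> real^'n \<Rightarrow> real" where
  "min_stage_cost F Q R x = (INF u\<in>input_set F. stage_cost Q R x u)"

text \<open>The infimum in \<open>min_stage_cost\<close> is attained at the zero input.\<close>

lemma min_stage_cost_eq:
  assumes "sym_posdef R"
  shows "min_stage_cost F Q R x = wnorm_sq Q x"
proof -
  have z: "0 \<in> input_set F"
    by (simp add: input_set_def)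
  have ge: "wnorm_sq Q x \<le> stage_cost Q R x u" for u
    using assms by (cases "u = 0") (auto simp: stage_cost_def wnorm_sq_def sym_posdef_def less_imp_le)
  have "min_stage_cost F Q R x = stage_cost Q R x 0"
    unfolding min_stage_cost_def
  proof (rule cInf_eq_minimum)
    show "stage_cost Q R x 0 \<in> stage_cost Q R x ` input_set F"
      using z by (rule imageI)
    show "stage_cost Q R x 0 \<le> c" if "c \<in> stage_cost Q R x ` input_set F" for c
      using that ge by (auto simp: stage_cost_def wnorm_sq_def)
  qed
  then show ?thesis
    by (simp add: stage_cost_def wnorm_sq_def)
qed

definition V_inf ::
  "real^'n^'n \<Rightarrow> real^'m^'n \<Rightarrow> real^'m^'c \<Rightarrow> real^'n^'n \<Rightarrow> real^'m^'m \<Rightarrow> real^'n \<Rightarrow> ereal" where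
  "V_inf A B F Q R x =
     (INF u \<in> {u. \<forall>t. u t \<in> input_set F}. \<Sum>t. ereal (stage_cost Q R (traj A B x u t) (u t)))"

definition horizon_cost ::
  "real^'n^'n \<Rightarrow> real^'m^'n \<Rightarrow> real^'n^'n \<Rightarrow> real^'m^'m \<Rightarrow> nat \<Rightarrow> real^'n \<Rightarrow> (nat \<Rightarrow> real^'m) \<Rightarrow> real" where
  "horizon_cost A B Q R N x u = (\<Sum>k=0..N. stage_cost Q R (traj A B x u k) (u k))"

definition feasible_inputs :: "real^'m^'c \<Rightarrow> nat \<Rightarrow> (nat \<Rightarrow> real^'m) set" where
  "feasible_inputs F N = {u. \<forall>k\<le>N. u k \<in> input_set F}"

definition V_mpc ::
  "real^'n^'n \<Rightarrow> real^'m^'n \<Rightarrow> real^'m^'c \<Rightarrow> real^'n^'n \<Rightarrow> real^'m^'m \<Rightarrow> nat \<Rightarrow> real^'n \<Rightarrow> real" where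
  "V_mpc A B F Q R N x = (INF u\<in>feasible_inputs F N. horizon_cost A B Q R N x u)"

text \<open>For positive definite weights the horizon cost is strictly convex and coercive in the
  inputs \<open>0, \<dots>, N\<close> and \<open>input_set F\<close> is closed and nonempty, so a minimizer
  exists and its values at \<open>0, \<dots>, N\<close> are unique; the choice below only concerns the irrelevant
  values beyond \<open>N\<close>.\<close>

definition mpc_law ::
  "real^'n^'n \<Rightarrow> real^'m^'n \<Rightarrow> real^'m^'c \<Rightarrow> real^'n^'n \<Rightarrow> real^'m^'m \<Rightarrow> nat \<Rightarrow> real^'n \<Rightarrow> real^'m" where
  "mpc_law A B F Q R N x =
     (SOME u. is_arg_min (horizon_cost A B Q R N x) (\<lambda>u. u \<in> feasible_inputs F N) u) 0"

definition closed_loop ::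
  "real^'n^'n \<Rightarrow> real^'m^'n \<Rightarrow> (real^'n \<Rightarrow> real^'m) \<Rightarrow> real^'n \<Rightarrow> real^'n" where
  "closed_loop A B \<mu> x = A *v x + B *v \<mu> x"

definition J_inf ::
  "real^'n^'n \<Rightarrow> real^'m^'n \<Rightarrow> real^'n^'n \<Rightarrow> real^'m^'m \<Rightarrow> (real^'n \<Rightarrow> real^'m) \<Rightarrow> real^'n \<Rightarrow> ereal" where
  "J_inf A B Q R \<mu> x =
     (\<Sum>t. ereal (stage_cost Q R ((closed_loop A B \<mu> ^^ t) x) (\<mu> ((closed_loop A B \<mu> ^^ t) x))))"

text \<open>A region of attraction of the origin for the autonomous system with successor map \<open>f\<close> is a
  positively invariant set of states from which the trajectory converges to the origin. The set of
  all attracted states is the largest one.\<close>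

definition region_of_attraction :: "('a::real_normed_vector \<Rightarrow> 'a) \<Rightarrow> 'a set \<Rightarrow> bool" where
  "region_of_attraction f X \<longleftrightarrow> f ` X \<subseteq> X \<and> (\<forall>x\<in>X. (\<lambda>t. (f ^^ t) x) \<longlonglongrightarrow> 0)"

lemma region_of_attraction_largest:
  "region_of_attraction f {x. (\<lambda>t. (f ^^ t) x) \<longlonglongrightarrow> 0}"
proof -
  have "(\<lambda>t. (f ^^ t) (f x)) \<longlonglongrightarrow> 0" if "(\<lambda>t. (f ^^ t) x) \<longlonglongrightarrow> 0" for x
    using LIMSEQ_Suc[OF that] by (simp add: funpow_swap1)
  then show ?thesis
    by (auto simp: region_of_attraction_def)
qed


section \<open>The functions in the bound on the nominal value function\<close>

text \<open>For \<open>\<nu> \<in> {1, 2}\<close>; \<open>a\<close> and \<open>b\<close> are the spectral norms of the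
  estimated matrices.\<close>

definition g_x :: "nat \<Rightarrow> real \<Rightarrow> real \<Rightarrow> nat \<Rightarrow> real" where
  "g_x \<nu> a dA i = ((dA + a) ^ i - a ^ i) ^ \<nu>"

definition g_u :: "nat \<Rightarrow> real \<Rightarrow> real \<Rightarrow> real \<Rightarrow> real \<Rightarrow> nat \<Rightarrow> real" where
  "g_u \<nu> a b dA dB i = ((dB + b) * g_x 1 a dA i + dB * a ^ i) ^ \<nu>"

definition gbar_x :: "real^'n^'n \<Rightarrow> nat \<Rightarrow> real \<Rightarrow> real" where
  "gbar_x Ah N dA = (\<Sum>i=1..N. g_x 1 (spectral_norm Ah) dA i)"

definition gbar_u :: "real^'n^'n \<Rightarrow> real^'m^'n \<Rightarrow> nat \<Rightarrow> real \<Rightarrow> real \<Rightarrow> real" where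
  "gbar_u Ah Bh N dA dB =
     (\<Sum>i=1..N. \<Sum>j<i. g_u 1 (spectral_norm Ah) (spectral_norm Bh) dA dB j)"

definition Phi :: "real^'n^'n \<Rightarrow> nat \<Rightarrow> nat \<Rightarrow> real^'n^'n" where
  "Phi Ah i j = mpow Ah i"

definition Gam :: "real^'n^'n \<Rightarrow> real^'m^'n \<Rightarrow> nat \<Rightarrow> nat \<Rightarrow> real^'m^'n" where
  "Gam Ah Bh i j = (if j < i then mpow Ah (i - 1 - j) ** Bh else 0)"

definition norm_Phi :: "real^'n^'n \<Rightarrow> nat \<Rightarrow> real" where
  "norm_Phi Ah N = block_spectral_norm (N + 1) 1 (Phi Ah)"

definition norm_Gam :: "real^'n^'n \<Rightarrow> real^'m^'n \<Rightarrow> nat \<Rightarrow> real" where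
  "norm_Gam Ah Bh N = block_spectral_norm (N + 1) N (Gam Ah Bh)"

definition Hess ::
  "real^'n^'n \<Rightarrow> real^'m^'n \<Rightarrow> real^'n^'n \<Rightarrow> real^'m^'m \<Rightarrow> nat \<Rightarrow> nat \<Rightarrow> nat \<Rightarrow> real^'m^'m" where
  "Hess Ah Bh Q R N i j = block_diag R i j +
     block_mult (N + 1) (block_transpose (Gam Ah Bh))
       (block_mult (N + 1) (block_diag Q) (Gam Ah Bh)) i j"

definition theta_u ::
  "real^'n^'n \<Rightarrow> real^'m^'n \<Rightarrow> real^'n^'n \<Rightarrow> nat \<Rightarrow> real \<Rightarrow> real \<Rightarrow> real" where
  "theta_u Ah Bh Q N dA dB =
     sig_max Q * (2 * norm_Gam Ah Bh N * gbar_u Ah Bh N dA dB + (gbar_u Ah Bh N dA dB)\<^sup>2)"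

definition theta_xu ::
  "real^'n^'n \<Rightarrow> real^'m^'n \<Rightarrow> real^'n^'n \<Rightarrow> nat \<Rightarrow> real \<Rightarrow> real \<Rightarrow> real" where
  "theta_xu Ah Bh Q N dA dB =
     sig_max Q * (norm_Gam Ah Bh N * gbar_x Ah N dA + norm_Phi Ah N * gbar_u Ah Bh N dA dB
       + gbar_x Ah N dA * gbar_u Ah Bh N dA dB)"

text \<open>Maxima over the input set, which is closed; they are attained when it is bounded.\<close>

definition u_bar :: "real^'m^'c \<Rightarrow> real" where
  "u_bar F = (SUP u\<in>input_set F. (norm u)\<^sup>2)"

definition d_bar :: "real^'m^'c \<Rightarrow> real" where
  "d_bar F = (SUP (u1, u2)\<in>input_set F \<times> input_set F. (norm (u1 - u2))\<^sup>2)"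

definition E_psi ::
  "real^'n^'n \<Rightarrow> real^'m^'n \<Rightarrow> real^'m^'c \<Rightarrow> real^'n^'n \<Rightarrow> nat \<Rightarrow> real^'n \<Rightarrow> real \<Rightarrow> real \<Rightarrow> real" where
  "E_psi Ah Bh F Q N x dA dB = sig_max Q *
     (\<Sum>k=0..N. (g_x 2 (spectral_norm Ah) dA k
                  + (\<Sum>i<k. g_u 2 (spectral_norm Ah) (spectral_norm Bh) dA dB (k - i - 1)))
                * ((norm x)\<^sup>2 + real k * u_bar F))"

definition E_u ::
  "real^'n^'n \<Rightarrow> real^'m^'n \<Rightarrow> real^'m^'c \<Rightarrow> real^'n^'n \<Rightarrow> real^'m^'m \<Rightarrow> nat
     \<Rightarrow> real^'n \<Rightarrow> real \<Rightarrow> real \<Rightarrow> real" where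
  "E_u Ah Bh F Q R N x dA dB = sig_max R *
     (min (sqrt (real N * d_bar F))
          (1 / block_sig_min N (Hess Ah Bh Q R N) *
            (sqrt (real N * u_bar F) * theta_u Ah Bh Q N dA dB
              + norm x * theta_xu Ah Bh Q N dA dB)))\<^sup>2"

definition E_psi_u ::
  "real^'n^'n \<Rightarrow> real^'m^'n \<Rightarrow> real^'m^'c \<Rightarrow> real^'n^'n \<Rightarrow> real^'m^'m \<Rightarrow> nat
     \<Rightarrow> real^'n \<Rightarrow> real \<Rightarrow> real \<Rightarrow> real" where
  "E_psi_u Ah Bh F Q R N x dA dB =
     sig_max Q / sig_max R * (norm_Gam Ah Bh N + gbar_u Ah Bh N dA dB)\<^sup>2 * E_u Ah Bh F Q R N x dA dB"

definition alpha_N ::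
  "real^'n^'n \<Rightarrow> real^'m^'n \<Rightarrow> real^'m^'c \<Rightarrow> real^'n^'n \<Rightarrow> real^'m^'m \<Rightarrow> nat
     \<Rightarrow> (nat \<Rightarrow> real) \<Rightarrow> real^'n \<Rightarrow> real \<Rightarrow> real \<Rightarrow> real" where
  "alpha_N Ah Bh F Q R N p x dA dB =
     (let e = E_psi Ah Bh F Q N x dA dB;
          eu = E_u Ah Bh F Q R N x dA dB;
          epu = E_psi_u Ah Bh F Q R N x dA dB
      in max (p 1 * sqrt e + p 3 * sqrt epu + p 1 * p 3 * sqrt (e * epu)) (p 2 * sqrt eu))"

definition beta_N ::
  "real^'n^'n \<Rightarrow> real^'m^'n \<Rightarrow> real^'m^'c \<Rightarrow> real^'n^'n \<Rightarrow> real^'m^'m \<Rightarrow> nat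
     \<Rightarrow> (nat \<Rightarrow> real) \<Rightarrow> (nat \<Rightarrow> real) \<Rightarrow> real^'n \<Rightarrow> real \<Rightarrow> real \<Rightarrow> real" where
  "beta_N Ah Bh F Q R N p q x dA dB =
     (let e = E_psi Ah Bh F Q N x dA dB;
          eu = E_u Ah Bh F Q R N x dA dB;
          epu = E_psi_u Ah Bh F Q R N x dA dB
      in (1 + p 1 * sqrt e) * (q 3 * sqrt epu + epu) + q 2 * sqrt eu + eu + q 1 * sqrt e + e)"


section \<open>The functions in the decrease condition\<close>

text \<open>Extended real, since a zero row of \<open>F ** K\<close> imposes no restriction and contributes
  \<open>1 / 0 = \<infinity>\<close>.\<close>

definition eps_K :: "real^'m^'c \<Rightarrow> real^'n^'n \<Rightarrow> real^'n^'m \<Rightarrow> ereal" where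
  "eps_K F Q K = (MIN i. 1 / ereal (wnorm_sq (matrix_inv Q) (row i (F ** K))))"

definition Omega_K ::
  "real^'m^'c \<Rightarrow> real^'n^'n \<Rightarrow> real^'m^'m \<Rightarrow> real^'n^'m \<Rightarrow> (real^'n) set" where
  "Omega_K F Q R K = {x. ereal (min_stage_cost F Q R x) \<le> eps_K F Q K}"

definition C_K :: "real^'n^'n \<Rightarrow> real^'m^'m \<Rightarrow> real^'n^'m \<Rightarrow> real \<Rightarrow> real" where
  "C_K Q R K lam =
     (1 + inverse (sig_min Q) * sig_max R * (spectral_norm K)\<^sup>2) * cond_ratio Q * lam\<^sup>2"

definition gam :: "real^'n^'n \<Rightarrow> real^'m^'m \<Rightarrow> real^'n^'m \<Rightarrow> real \<Rightarrow> real \<Rightarrow> real" where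
  "gam Q R K lam rho = C_K Q R K lam * inverse (1 - rho)"

definition rho_gam :: "real \<Rightarrow> real" where
  "rho_gam g = inverse g * (g - 1)"

definition L_V :: "real \<Rightarrow> ereal \<Rightarrow> real \<Rightarrow> real" where
  "L_V g eps M = max g (real_of_ereal (ereal M / eps))"

text \<open>Infinite \<open>eps\<close> gives the value 0.\<close>

definition N_0 :: "real \<Rightarrow> ereal \<Rightarrow> real \<Rightarrow> int" where
  "N_0 g eps M = \<lceil>max 0 (real_of_ereal ((ereal M - ereal g * eps) / eps))\<rceil>"

text \<open>The exponent \<open>N - N_0\<close> may be negative, hence the integer power.\<close>

definition gam_decay :: "real \<Rightarrow> ereal \<Rightarrow> real \<Rightarrow> nat \<Rightarrow> real" where
  "gam_decay g eps M N = g * rho_gam g powi (int N - N_0 g eps M)"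

definition G_N :: "real^'n^'n \<Rightarrow> nat \<Rightarrow> real" where
  "G_N Ah N = (\<Sum>i=1..N-1. spectral_norm Ah ^ (2 * (i - 1)))"

definition h_err :: "real^'n^'n \<Rightarrow> real^'m^'m \<Rightarrow> real \<Rightarrow> real \<Rightarrow> real" where
  "h_err Q R dA dB = inverse (sig_min Q) * dA\<^sup>2 + inverse (sig_min R) * dB\<^sup>2"

definition omega_one :: "real^'n^'n \<Rightarrow> real^'n^'n \<Rightarrow> nat \<Rightarrow> real" where
  "omega_one Ah Q N = sig_max Q *
     ((1 + (spectral_norm Ah)\<^sup>2 * cond_ratio Q) * spectral_norm Ah ^ (2 * (N - 1)) + G_N Ah N)"

definition omega_half ::
  "real^'n^'n \<Rightarrow> real^'n^'n \<Rightarrow> real \<Rightarrow> ereal \<Rightarrow> real \<Rightarrow> nat \<Rightarrow> real" where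
  "omega_half Ah Q g eps M N =
     sqrt (sig_max Q * (L_V g eps M - 1) * G_N Ah N)
     + (1 + (spectral_norm Ah)\<^sup>2 * cond_ratio Q) / 2
       * sqrt (sig_max Q * spectral_norm Ah ^ (2 * (N - 1)) * gam_decay g eps M N)"

definition eta_N ::
  "real^'n^'n \<Rightarrow> real^'m^'c \<Rightarrow> real^'n^'n \<Rightarrow> real^'m^'m \<Rightarrow> nat
     \<Rightarrow> real^'n^'m \<Rightarrow> real \<Rightarrow> real \<Rightarrow> real \<Rightarrow> real" where
  "eta_N Ah F Q R N K lam rho M =
     (spectral_norm Ah)\<^sup>2 * cond_ratio Q * gam_decay (gam Q R K lam rho) (eps_K F Q K) M N"

definition xi_N ::
  "real^'n^'n \<Rightarrow> real^'m^'c \<Rightarrow> real^'n^'n \<Rightarrow> real^'m^'m \<Rightarrow> nat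
     \<Rightarrow> real^'n^'m \<Rightarrow> real \<Rightarrow> real \<Rightarrow> real \<Rightarrow> real \<Rightarrow> real \<Rightarrow> real" where
  "xi_N Ah F Q R N K lam rho M dA dB =
     omega_one Ah Q N * h_err Q R dA dB
     + 2 * omega_half Ah Q (gam Q R K lam rho) (eps_K F Q K) M N * sqrt (h_err Q R dA dB)"

end

theory Submission
  imports Defs
begin

text \<open>The optimal value \<open>V\<close> of the nominal problem is a Lyapunov function for the true closed loop.
  The decrease condition holds along the whole trajectory, because the region of attraction is
  invariant. Summed over the first \<open>n\<close> steps, its left-hand side telescopes, so that
  \<open>(1 - \<xi> - \<eta>)\<close> times the accumulated stage cost is at most \<open>V x - V (x n)\<close>. Since \<open>V\<close> is a value
  of a nonnegative cost, the term \<open>V (x n)\<close> can be dropped, and the bound \<open>V x / (1 - \<xi> - \<eta>)\<close> is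
  uniform in \<open>n\<close>. It therefore bounds the infinite-horizon cost
  (\<open>suminf_le_of_lyapunov_decrease\<close>). The bound on \<open>V x\<close> in terms of \<open>V\<^sub>\<infinity> x\<close>, applied only at the
  initial state, gives the theorem.\<close>

lemma wnorm_sq_nonneg: "sym_posdef M \<Longrightarrow> 0 \<le> wnorm_sq M v"
  by (cases "v = 0") (auto simp: wnorm_sq_def sym_posdef_def less_imp_le)

lemma stage_cost_nonneg: "sym_posdef Q \<Longrightarrow> sym_posdef R \<Longrightarrow> 0 \<le> stage_cost Q R x u"
  by (simp add: stage_cost_def wnorm_sq_nonneg)

lemma V_mpc_nonneg:
  assumes "sym_posdef Q" and "sym_posdef R"
  shows "0 \<le> V_mpc A B F Q R N x"
  unfolding V_mpc_def
proof (rule cINF_greatest)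
  \<comment> \<open>On the reals the infimum over the empty set is arbitrary; the zero input is feasible.\<close>
  have "(\<lambda>k. 0) \<in> feasible_inputs F N"
    by (simp add: feasible_inputs_def input_set_def)
  then show "feasible_inputs F N \<noteq> {}"
    by blast
  show "0 \<le> horizon_cost A B Q R N x u" for u
    unfolding horizon_cost_def using assms by (intro sum_nonneg stage_cost_nonneg)
qed

text \<open>The telescoped decrease bounds every partial sum by \<open>(V x - V ((f ^^ n) x)) / c\<close>, hence by
  \<open>V x / c\<close>. The sum is taken in the extended reals, so that its finiteness is part of the
  conclusion.\<close>

lemma suminf_le_of_lyapunov_decrease:
  fixes f :: "'a \<Rightarrow> 'a" and V l :: "'a \<Rightarrow> real"
  assumes invariant: "f ` X \<subseteq> X" and x: "x \<in> X"
    and V: "\<And>z. z \<in> X \<Longrightarrow> 0 \<le> V z" and l: "\<And>z. z \<in> X \<Longrightarrow> 0 \<le> l z"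
    and c: "0 < c" and decrease: "\<And>z. z \<in> X \<Longrightarrow> V (f z) - V z \<le> - c * l z"
  shows "(\<Sum>t. ereal (l ((f ^^ t) x))) \<le> ereal (V x / c)"
proof (rule suminf_bound[OF allI])
  have orbit: "(f ^^ t) x \<in> X" for t
    using invariant x by (induction t) auto
  show "0 \<le> ereal (l ((f ^^ t) x))" for t
    using l[OF orbit] by simp
  have telescoped: "c * (\<Sum>t<n. l ((f ^^ t) x)) \<le> V x - V ((f ^^ n) x)" for n
  proof (induction n)
    case (Suc n)
    then show ?case
      using decrease[OF orbit[of n]] by (simp add: distrib_left)
  qed simp
  show "(\<Sum>t<n. ereal (l ((f ^^ t) x))) \<le> ereal (V x / c)" for n
  proof -
    have "c * (\<Sum>t<n. l ((f ^^ t) x)) \<le> V x"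
      using telescoped[of n] V[OF orbit[of n]] by linarith
    then have "(\<Sum>t<n. l ((f ^^ t) x)) \<le> V x / c"
      using c by (simp add: pos_le_divide_eq mult.commute)
    then show ?thesis
      by simp
  qed
qed

theorem theorem1:
  fixes A Ah :: "real^'n^'n" and B Bh :: "real^'m^'n"
    and F :: "real^'m^'c"
    and Q :: "real^'n^'n" and R :: "real^'m^'m"
    and \<delta>A \<delta>B :: real
    and N :: nat
    and p q :: "nat \<Rightarrow> real"
    and K :: "real^'n^'m"
    and lam rho M :: real
    and \<mu> :: "real^'n \<Rightarrow> real^'m"
    and Vinf :: "real^'n \<Rightarrow> ereal" and V :: "real^'n \<Rightarrow> real"
    and \<alpha> \<beta> :: "real^'n \<Rightarrow> real \<Rightarrow> real \<Rightarrow> real"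
    and \<xi> :: "real \<Rightarrow> real \<Rightarrow> real" and \<eta> :: real
    and X :: "(real^'n) set" and x :: "real^'n"
  assumes Q: "sym_posdef Q" and R: "sym_posdef R"
    and U: "bounded (input_set F)"
    and \<delta>: "0 \<le> \<delta>A" "0 \<le> \<delta>B"
    and est: "norm (A - Ah) \<le> \<delta>A" "norm (B - Bh) \<le> \<delta>B"
    and stab: "stabilizable A B" "stabilizable Ah Bh"
    and N: "1 \<le> N"
    and pq: "\<And>i. i \<in> {1, 2, 3} \<Longrightarrow> 0 \<le> p i \<and> 0 \<le> q i \<and> p i * q i = 1"
    and Vinf_def: "Vinf = V_inf A B F Q R"
    and V_def: "V = V_mpc Ah Bh F Q R N"
    and \<mu>_def: "\<mu> = mpc_law Ah Bh F Q R N"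
    and ROA: "region_of_attraction (closed_loop A B \<mu>) X"
    and fin: "\<And>z. z \<in> X \<Longrightarrow> Vinf z < \<infinity>"
    and x: "x \<in> X"
    and K: "stabilizing_gain Ah Bh K"
    and lam_rho: "1 \<le> lam" "0 < rho" "rho < 1"
    and decay: "\<And>z k. z \<in> Omega_K F Q R K \<Longrightarrow>
        stage_cost Q R (mpow (Ah + Bh ** K) k *v z) (K *v (mpow (Ah + Bh ** K) k *v z))
          \<le> C_K Q R K lam * rho ^ k * min_stage_cost F Q R z"
    and M: "V x \<le> M"
    and \<alpha>_def: "\<alpha> = alpha_N Ah Bh F Q R N p"
    and \<beta>_def: "\<beta> = beta_N Ah Bh F Q R N p q"
    and \<xi>_def: "\<xi> = xi_N Ah F Q R N K lam rho M"
    and \<eta>_def: "\<eta> = eta_N Ah F Q R N K lam rho M"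
    and consistent: "\<And>z. z \<in> X \<Longrightarrow> error_consistent (\<alpha> z)"
        "\<And>z. z \<in> X \<Longrightarrow> error_consistent (\<beta> z)"
        "error_consistent \<xi>"
    and value_bound: "\<And>z. z \<in> X \<Longrightarrow>
        ereal (V z) \<le> ereal (1 + \<alpha> z \<delta>A \<delta>B) * Vinf z + ereal (\<beta> z \<delta>A \<delta>B)"
    and lt_1: "\<xi> \<delta>A \<delta>B + \<eta> < 1"
    and decrease: "\<And>z. z \<in> X \<Longrightarrow>
        V (A *v z + B *v \<mu> z) - V z \<le> - (1 - \<xi> \<delta>A \<delta>B - \<eta>) * stage_cost Q R z (\<mu> z)"
  shows "J_inf A B Q R \<mu> x
    \<le> ereal ((1 + \<alpha> x \<delta>A \<delta>B) / (1 - \<xi> \<delta>A \<delta>B - \<eta>)) * Vinf x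
       + ereal (\<beta> x \<delta>A \<delta>B / (1 - \<xi> \<delta>A \<delta>B - \<eta>))"
proof -
  define c where "c = 1 - \<xi> \<delta>A \<delta>B - \<eta>"
  have c: "0 < c"
    using lt_1 by (simp add: c_def)
  have "J_inf A B Q R \<mu> x \<le> ereal (V x / c)"
    unfolding J_inf_def
  proof (rule suminf_le_of_lyapunov_decrease[where l = "\<lambda>z. stage_cost Q R z (\<mu> z)"])
    show "closed_loop A B \<mu> ` X \<subseteq> X"
      using ROA by (simp add: region_of_attraction_def)
    show "0 \<le> V z" for z
      using Q R by (simp add: V_def V_mpc_nonneg)
    show "0 \<le> stage_cost Q R z (\<mu> z)" for z
      using Q R by (rule stage_cost_nonneg)
    show "V (closed_loop A B \<mu> z) - V z \<le> - c * stage_cost Q R z (\<mu> z)" if "z \<in> X" for z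
      using decrease[OF that] by (simp add: closed_loop_def c_def)
  qed (use x c in auto)
  moreover have "ereal (V x / c) \<le> ereal ((1 + \<alpha> x \<delta>A \<delta>B) / c) * Vinf x + ereal (\<beta> x \<delta>A \<delta>B / c)"
  proof -
    \<comment> \<open>The optimal value is a real number, so the division by \<open>c\<close> can be done in the reals.\<close>
    have "0 \<le> Vinf x"
      unfolding Vinf_def V_inf_def
      using Q R by (intro INF_greatest suminf_nonneg summable_ereal_pos) (simp_all add: stage_cost_nonneg)
    then obtain v where v: "Vinf x = ereal v"
      using fin[OF x] by (cases "Vinf x") auto
    have "V x \<le> (1 + \<alpha> x \<delta>A \<delta>B) * v + \<beta> x \<delta>A \<delta>B"
      using value_bound[OF x] by (simp add: v)
    then have "V x / c \<le> ((1 + \<alpha> x \<delta>A \<delta>B) * v + \<beta> x \<delta>A \<delta>B) / c"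
      using c by (simp add: divide_right_mono)
    then show ?thesis
      by (simp add: v add_divide_distrib[of _ "\<beta> x \<delta>A \<delta>B"])
  qed
  ultimately show ?thesis
    unfolding c_def by (rule order_trans)
qed

end
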